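(* Let $p(X)=\det(X)$ be the determinant restricted to the space $\mathcal{S}^d$ of $d\times d$ real symmetric matrices, and let $I$ be the identity matrix. Then $\phi_{p,I}(\mathcal{S}^d,\mathbb{R}^d)=\Lambda_+(p,I)^*$.
   Context: The polynomial $p=\det$ on $\mathcal{S}^d$ is hyperbolic with respect to $e=I$, meaning that $p(e)>0$ and for every $X\in\mathcal{S}^d$ the polynomial $t\mapsto p(X+te)$ has only real zeros. The hyperbolicity cone $\Lambda_+(p,I)$ is the set of $X\in\mathcal{S}^d$ such that all zeros of $t\mapsto p(tI-X)$ are nonnegative, and its dual cone is $\Lambda_+(p,I)^*=\{\xi\in(\mathcal{S}^d)^*:\xi[X]\ge0\text{ for all }X\in\Lambda_+(p,I)\}$. For $X,U\in\mathcal{S}^d$ put $p_X(t)=p(X+tI)$ and $D_Up_X(t)=(D_Up)(X+tI)$, with $D_U$ the directional derivative. The parameterized Hermite matrix $H_{p,I}(X)[U]$ is the $d\times d$ Hankel matrix $[h_{i+j-1}]_{i,j=1}^d$, where $\frac{D_Up_X(t)}{p_X(t)}=\sum_{k\ge1}h_kt^{-k}$ (expansion at infinity); it is linear in $U$. For $(X,y)\in\mathcal{S}^d\times\mathbb{R}^d$, $\phi_{p,I}(X,y)\in(\mathcal{S}^d)^*$ is the linear functional $\phi_{p,I}(X,y)[U]=y^TH_{p,I}(X)[U]\,y$, and $\phi_{p,I}(\mathcal{S}^d,\mathbb{R}^d)$ is its image. *)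

theory Defs
  imports
    "HOL-Analysis.Derivative"
    "HOL-Library.FuncSet"
    "Jordan_Normal_Form.Determinant"
begin

definition sym_mats :: "nat \<Rightarrow> real mat set" where
  "sym_mats d = {X \<in> carrier_mat d d. transpose_mat X = X}"

text \<open>
  A functional on a subspace \<open>V\<close> of matrices is represented by the function on all of
  \<^typ>\<open>real mat\<close> that is \<^const>\<open>undefined\<close> outside \<open>V\<close>, so that two functionals
  are equal iff they agree on \<open>V\<close>.
\<close>

definition dual_space :: "real mat set \<Rightarrow> (real mat \<Rightarrow> real) set" where
  "dual_space V = {\<xi> \<in> extensional V.
     (\<forall>X\<in>V. \<forall>Y\<in>V. \<xi> (X + Y) = \<xi> X + \<xi> Y) \<and>
     (\<forall>c. \<forall>X\<in>V. \<xi> (c \<cdot>\<^sub>m X) = c * \<xi> X)}"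

text \<open>
  Only real zeros need to be mentioned in the hyperbolicity cone: if \<open>p\<close> is hyperbolic with
  respect to \<open>e\<close>, then all zeros of \<open>t \<mapsto> p (t e - X)\<close> are real.
\<close>

definition hyperbolicity_cone ::
    "real mat set \<Rightarrow> (real mat \<Rightarrow> real) \<Rightarrow> real mat \<Rightarrow> real mat set" where
  "hyperbolicity_cone V p e = {X \<in> V. \<forall>t. p (t \<cdot>\<^sub>m e - X) = 0 \<longrightarrow> 0 \<le> t}"

definition dual_cone :: "real mat set \<Rightarrow> real mat set \<Rightarrow> (real mat \<Rightarrow> real) set" where
  "dual_cone V K = {\<xi> \<in> dual_space V. \<forall>X\<in>K. 0 \<le> \<xi> X}"

definition directional_deriv ::
    "real mat \<Rightarrow> (real mat \<Rightarrow> real) \<Rightarrow> real mat \<Rightarrow> real" where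
  "directional_deriv U p X = deriv (\<lambda>s. p (X + s \<cdot>\<^sub>m U)) 0"

text \<open>
  The expansion at infinity starts with the power \<open>t\<^sup>-\<^sup>1\<close>; this is the condition
  \<open>h 0 = 0\<close>. Since \<^typ>\<open>real\<close> is the type of \<open>t\<close>, the filter
  \<^const>\<open>at_infinity\<close> refers to all sufficiently large \<open>\<bar>t\<bar>\<close>.
\<close>

definition hermite_coeff ::
    "(real mat \<Rightarrow> real) \<Rightarrow> real mat \<Rightarrow> real mat \<Rightarrow> real mat \<Rightarrow> nat \<Rightarrow> real" where
  "hermite_coeff p e X U = (THE h. h 0 = 0 \<and>
     (\<forall>\<^sub>F t in at_infinity.
        (\<lambda>k. h k / t ^ k) sums (directional_deriv U p (X + t \<cdot>\<^sub>m e) / p (X + t \<cdot>\<^sub>m e))))"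

text \<open>
  Matrix indices start at \<open>0\<close>, so the entry \<open>h\<^sub>i\<^sub>+\<^sub>j\<^sub>-\<^sub>1\<close> (with \<open>i, j\<close> counted from
  \<open>1\<close>) becomes \<open>h (i + j + 1)\<close>.
\<close>

definition hermite_mat ::
    "nat \<Rightarrow> (real mat \<Rightarrow> real) \<Rightarrow> real mat \<Rightarrow> real mat \<Rightarrow> real mat \<Rightarrow> real mat" where
  "hermite_mat d p e X U = mat d d (\<lambda>(i, j). hermite_coeff p e X U (i + j + 1))"

definition hermite_map ::
    "nat \<Rightarrow> (real mat \<Rightarrow> real) \<Rightarrow> real mat \<Rightarrow> real mat \<times> real vec \<Rightarrow> real mat \<Rightarrow> real" where
  "hermite_map d p e = (\<lambda>(X, y). \<lambda>U \<in> sym_mats d.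
     scalar_prod y (hermite_mat d p e X U *\<^sub>v y))"

end

theory Submission
  imports Defs "Jordan_Normal_Form.Char_Poly" "HOL-Computational_Algebra.Fundamental_Theorem_Algebra"
begin

text \<open>
  Diagonalize \<open>X = Q diag(l) Q\<^sup>T\<close> with \<open>Q\<close> orthogonal and put \<open>V = Q\<^sup>T U Q\<close>. Then
  \<open>det (X + t I + s U) = det (diag(l + t) + s V)\<close>, whose logarithmic derivative at \<open>s = 0\<close> is
  \<open>\<Sum>i. V i i / (l i + t)\<close>. Expanding each summand as a geometric series in \<open>1 / t\<close> gives
  \<open>h (k + 1) = \<Sum>i. V i i (- l i) ^ k\<close>, so that the Hermite form is
  \<open>y\<^sup>T H y = \<Sum>i. V i i q(- l i)\<^sup>2\<close> with the polynomial \<open>q(t) = \<Sum>k. y k t ^ k\<close>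
  (lemma \<open>hermite_mat_quadratic_form\<close>); equivalently it is the trace of \<open>q(- X)\<^sup>2 U\<close>.

  If \<open>U\<close> lies in the hyperbolicity cone, its eigenvalues are nonnegative, so the diagonal of
  \<open>Q\<^sup>T U Q\<close> is nonnegative and hence so is the form. This is one inclusion.

  Conversely, every functional on symmetric matrices is the trace form of a symmetric matrix \<open>A\<close>.
  If \<open>A = Q diag(\<alpha>) Q\<^sup>T\<close>, the functional is \<open>U \<mapsto> \<Sum>i. \<alpha> i (Q\<^sup>T U Q) i i\<close>. Evaluation at
  the rank-one projections \<open>Q diag(e\<^sub>i) Q\<^sup>T\<close>, which lie in the cone, shows \<open>\<alpha> i \<ge> 0\<close> for a
  functional in the dual cone. It remains to choose \<open>l\<close> and \<open>y\<close> with \<open>q(- l i)\<^sup>2 = \<alpha> i\<close>: in dimension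
  at least two, \<open>q(t) = t\<close> and \<open>l i = - sqrt (\<alpha> i)\<close> do, which amounts to taking for \<open>- X\<close> the
  square root of \<open>A\<close>.

  The spectral theorem used throughout is proved by induction on the dimension, splitting
  off one eigenvector by a Householder reflection.
\<close>

(* The symbol $ is to denote vec_index only, not the component of a Cartesian vector type. *)
unbundle no vec_syntax

section \<open>The spectral theorem for real symmetric matrices\<close>

lemma sym_mats_carrier: "A \<in> sym_mats n \<Longrightarrow> A \<in> carrier_mat n n"
  by (simp add: sym_mats_def)

lemma sym_mats_index_commute:
  assumes "A \<in> sym_mats n" "i < n" "j < n"
  shows "A $$ (j, i) = A $$ (i, j)"
  using assms unfolding sym_mats_def by (metis (mono_tags, lifting) CollectD carrier_matD index_transpose_mat(1))

lemma scalar_prod_symmetric_mat: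
  fixes A :: "real mat"
  assumes A: "A \<in> sym_mats n" and x: "x \<in> carrier_vec n" and y: "y \<in> carrier_vec n"
  shows "scalar_prod x (A *\<^sub>v y) = scalar_prod y (A *\<^sub>v x)"
proof -
  have c: "A \<in> carrier_mat n n" and t: "transpose_mat A = A" using A by (auto simp: sym_mats_def)
  have "scalar_prod (A *\<^sub>v x) y = scalar_prod x (A *\<^sub>v y)"
    using transpose_vec_mult_scalar[OF c y x] t by simp
  then show ?thesis
    using c x y by (metis comm_scalar_prod mult_mat_vec_carrier)
qed

text \<open>
  The fundamental theorem of algebra gives a complex eigenvalue \<open>z\<close> with eigenvector \<open>x + \<i> y\<close>.
  Comparing \<open>x\<^sup>T A y\<close> with \<open>y\<^sup>T A x\<close> yields \<open>Im z (x\<^sup>T x + y\<^sup>T y) = 0\<close>; hence \<open>z\<close> is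
  real, and whichever of \<open>x\<close> and \<open>y\<close> is nonzero is a real eigenvector.
\<close>

lemma sym_mats_eigenvector:
  assumes A: "A \<in> sym_mats n" and n: "0 < n"
  obtains v k where "v \<in> carrier_vec n" "v \<noteq> 0\<^sub>v n" "A *\<^sub>v v = k \<cdot>\<^sub>v v"
proof -
  have c: "A \<in> carrier_mat n n" using A by (auto simp: sym_mats_def)
  define B where "B = map_mat complex_of_real A"
  have B: "B \<in> carrier_mat n n" using c by (simp add: B_def)
  have "degree (char_poly B) = n" using degree_monic_char_poly[OF B] by simp
  then have "\<not> constant (poly (char_poly B))"
    using n by (simp add: constant_degree)
  then obtain z where "poly (char_poly B) z = 0"
    using fundamental_theorem_of_algebra by blast
  then have "eigenvalue B z" using eigenvalue_root_char_poly[OF B] by simp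
  then obtain w where w: "w \<in> carrier_vec n" "w \<noteq> 0\<^sub>v n" "B *\<^sub>v w = z \<cdot>\<^sub>v w"
    using B by (auto simp: eigenvalue_def eigenvector_def)
  define x y where "x = map_vec Re w" and "y = map_vec Im w"
  have x: "x \<in> carrier_vec n" and y: "y \<in> carrier_vec n"
    using w(1) by (auto simp: x_def y_def)
  have entry: "(\<Sum>j = 0..<n. complex_of_real (A $$ (i, j)) * (w $ j)) = z * (w $ i)"
    if i: "i < n" for i
  proof -
    have "(B *\<^sub>v w) $ i = z * (w $ i)" using w i by simp
    then show ?thesis using c w(1) i by (simp add: B_def scalar_prod_def)
  qed
  have Ax: "A *\<^sub>v x = Re z \<cdot>\<^sub>v x - Im z \<cdot>\<^sub>v y"
  proof (rule eq_vecI)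
    fix i assume "i < dim_vec (Re z \<cdot>\<^sub>v x - Im z \<cdot>\<^sub>v y)"
    then have i: "i < n" using y by simp
    show "(A *\<^sub>v x) $ i = (Re z \<cdot>\<^sub>v x - Im z \<cdot>\<^sub>v y) $ i"
      using arg_cong[OF entry[OF i], of Re] i c w(1) by (simp add: scalar_prod_def x_def y_def)
  qed (use c y in auto)
  have Ay: "A *\<^sub>v y = Re z \<cdot>\<^sub>v y + Im z \<cdot>\<^sub>v x"
  proof (rule eq_vecI)
    fix i assume "i < dim_vec (Re z \<cdot>\<^sub>v y + Im z \<cdot>\<^sub>v x)"
    then have i: "i < n" using x by simp
    show "(A *\<^sub>v y) $ i = (Re z \<cdot>\<^sub>v y + Im z \<cdot>\<^sub>v x) $ i"
      using arg_cong[OF entry[OF i], of Im] i c w(1) by (simp add: scalar_prod_def x_def y_def)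
  qed (use c x in auto)
  have xy: "x \<noteq> 0\<^sub>v n \<or> y \<noteq> 0\<^sub>v n"
  proof (rule ccontr)
    assume "\<not> ?thesis"
    then have 0: "x = 0\<^sub>v n" "y = 0\<^sub>v n" by auto
    have "w $ i = 0" if "i < n" for i
      using arg_cong[OF 0(1), of "\<lambda>v. v $ i"] arg_cong[OF 0(2), of "\<lambda>v. v $ i"] that w(1)
      by (simp add: x_def y_def complex_eq_iff)
    then have "w = 0\<^sub>v n" using w(1) by (intro eq_vecI) auto
    with w(2) show False by simp
  qed
  have pos: "0 < scalar_prod v v" if "v \<in> carrier_vec n" "v \<noteq> 0\<^sub>v n" for v :: "real vec"
    using conjugate_square_greater_0_vec[OF that(1)] that(2) by simp
  have nonneg: "0 \<le> scalar_prod v v" for v :: "real vec"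
    by (simp add: scalar_prod_def sum_nonneg)
  have "scalar_prod x (A *\<^sub>v y) = Re z * scalar_prod x y + Im z * scalar_prod x x"
    unfolding Ay using x y by (simp add: scalar_prod_add_distrib[of _ n])
  moreover have "scalar_prod y (A *\<^sub>v x) = Re z * scalar_prod x y - Im z * scalar_prod y y"
    unfolding Ax using x y by (simp add: scalar_prod_minus_distrib[of _ n] comm_scalar_prod[of y n x])
  ultimately have "Im z * (scalar_prod x x + scalar_prod y y) = 0"
    using scalar_prod_symmetric_mat[OF A x y] by (simp add: algebra_simps)
  moreover have "0 < scalar_prod x x + scalar_prod y y"
    using xy pos[OF x] pos[OF y] nonneg[of x] nonneg[of y] by (meson add_nonneg_pos add_pos_nonneg)
  ultimately have "Im z = 0" by simp
  then have "A *\<^sub>v x = Re z \<cdot>\<^sub>v x" "A *\<^sub>v y = Re z \<cdot>\<^sub>v y" using Ax Ay x y by auto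
  with xy x y that show ?thesis by blast
qed

text \<open>
  The matrix is the Householder reflection \<open>I - 2 w w\<^sup>T / (w\<^sup>T w)\<close> with \<open>w = e\<^sub>0 - v\<close>, which
  exchanges the unit vectors \<open>e\<^sub>0\<close> and \<open>v\<close>, or the identity if these coincide. Since \<open>w\<^sup>T w = 2 w 0\<close>, the factor
  \<open>2 / (w\<^sup>T w)\<close> is \<open>1 / w 0\<close>.
\<close>

lemma orthogonal_mat_first_column:
  fixes v :: "real vec"
  assumes v: "v \<in> carrier_vec (Suc n)" and unit: "scalar_prod v v = 1"
  obtains H where "H \<in> carrier_mat (Suc n) (Suc n)" "transpose_mat H * H = 1\<^sub>m (Suc n)"
    "col H 0 = v"
proof (cases "v = unit_vec (Suc n) 0")
  case True
  then show ?thesis using that[of "1\<^sub>m (Suc n)"] by simp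
next
  case False
  let ?I = "{0..<Suc n}"
  define w where "w i = (if i = 0 then 1 else 0) - v $ i" for i
  have vv: "(\<Sum>i\<in>?I. v $ i * v $ i) = 1" using unit v by (simp add: scalar_prod_def)
  have "(\<Sum>i\<in>?I. w i * w i) = (\<Sum>i\<in>?I. (if i = 0 then 1 - 2 * v $ 0 else 0) + v $ i * v $ i)"
    by (rule sum.cong) (auto simp: w_def algebra_simps)
  also have "\<dots> = 2 * w 0"
    unfolding sum.distrib vv by (subst sum.delta) (auto simp: w_def)
  finally have ww: "(\<Sum>i\<in>?I. w i * w i) = 2 * w 0" .
  have w0: "w 0 \<noteq> 0"
  proof
    assume "w 0 = 0"
    then have "\<forall>i\<in>?I. w i * w i = 0" using ww
      by (subst sum_nonneg_eq_0_iff[symmetric]) auto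
    then have "v = unit_vec (Suc n) 0" using v
      by (intro eq_vecI) (auto simp: w_def)
    with False show False by simp
  qed
  define c where "c = 1 / w 0"
  have c: "w 0 * c = 1" using w0 by (simp add: c_def)
  define H where "H = mat (Suc n) (Suc n) (\<lambda>(i, j). (if i = j then 1 else 0) - c * w i * w j)"
  show ?thesis
  proof (rule that)
    show "H \<in> carrier_mat (Suc n) (Suc n)" by (simp add: H_def)
    show "transpose_mat H * H = 1\<^sub>m (Suc n)"
    proof (rule eq_matI)
      fix i j assume "i < dim_row (1\<^sub>m (Suc n))" "j < dim_col (1\<^sub>m (Suc n))"
      then have i: "i < Suc n" and j: "j < Suc n" by auto
      have "(transpose_mat H * H) $$ (i, j) = (\<Sum>k\<in>?I. ((if k = i then 1 else 0) - c * w k * w i) *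
          ((if k = j then 1 else 0) - c * w k * w j))"
        using i j by (simp add: H_def scalar_prod_def del: sum.op_ivl_Suc)
      also have "\<dots> = (\<Sum>k\<in>?I. (if k = i then (if i = j then 1 else 0) - c * w i * w j else 0)
          - (if k = j then c * w i * w j else 0) + w k * w k * (c * c * w i * w j))"
        by (rule sum.cong) (auto simp: algebra_simps)
      also have "\<dots> = (if i = j then 1 else 0) - 2 * c * w i * w j
          + (\<Sum>k\<in>?I. w k * w k) * (c * c * w i * w j)"
        unfolding sum.distrib sum_subtractf sum_distrib_right[symmetric]
        using i j by simp
      also have "\<dots> = (if i = j then 1 else 0) + (w 0 * c - 1) * (2 * c * w i * w j)"
        unfolding ww by (simp add: algebra_simps)
      finally show "(transpose_mat H * H) $$ (i, j) = 1\<^sub>m (Suc n) $$ (i, j)" using i j c by simp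
    qed (auto simp: H_def)
    show "col H 0 = v"
    proof (rule eq_vecI)
      fix i assume "i < dim_vec v"
      then have i: "i < Suc n" using v by simp
      have "col H 0 $ i = (if i = 0 then 1 else 0) - (w 0 * c) * w i" using i by (simp add: H_def)
      then show "col H 0 $ i = v $ i" unfolding c by (simp add: w_def)
    qed (use v in \<open>auto simp: H_def\<close>)
  qed
qed

text \<open>
  Induction step: with an orthogonal \<open>H\<close> whose first column is a unit eigenvector, the symmetric
  matrix \<open>H\<^sup>T A H\<close> is block diagonal with a block of size one, and the induction hypothesis
  diagonalizes the other block.
\<close>

theorem spectral_theorem_sym_mats:
  assumes "A \<in> sym_mats n"
  obtains Q l where "Q \<in> carrier_mat n n" "transpose_mat Q * Q = 1\<^sub>m n"
    "A = Q * mat_diag n l * transpose_mat Q"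
proof -
  have "\<exists>Q l. Q \<in> carrier_mat n n \<and> transpose_mat Q * Q = 1\<^sub>m n \<and> transpose_mat Q * A * Q = mat_diag n l"
    using assms
  proof (induction n arbitrary: A)
    case 0
    then show ?case
      by (intro exI[of _ "1\<^sub>m 0"] exI[of _ "\<lambda>_. 0"]) (auto simp: sym_mats_def mat_diag_def intro!: eq_matI)
  next
    case (Suc n)
    let ?n = "Suc n"
    have A: "A \<in> carrier_mat ?n ?n" and At: "transpose_mat A = A"
      using Suc.prems by (auto simp: sym_mats_def)
    obtain u k where u: "u \<in> carrier_vec ?n" "u \<noteq> 0\<^sub>v ?n" "A *\<^sub>v u = k \<cdot>\<^sub>v u"
      using sym_mats_eigenvector[OF Suc.prems] by blast
    have uu: "0 < scalar_prod u u"
      using conjugate_square_greater_0_vec[OF u(1)] u(2) by simp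
    define v where "v = (1 / sqrt (scalar_prod u u)) \<cdot>\<^sub>v u"
    have v: "v \<in> carrier_vec ?n" using u by (simp add: v_def)
    have vv: "scalar_prod v v = 1" using uu u(1) by (simp add: v_def)
    have Av: "A *\<^sub>v v = k \<cdot>\<^sub>v v"
      using u A by (simp add: v_def mult_mat_vec[OF A u(1)] smult_smult_assoc mult.commute)
    obtain H where H: "H \<in> carrier_mat ?n ?n" and HH: "transpose_mat H * H = 1\<^sub>m ?n" and Hv: "col H 0 = v"
      using orthogonal_mat_first_column[OF v vv] by blast
    define B where "B = transpose_mat H * A * H"
    have B: "B \<in> carrier_mat ?n ?n" using H A by (simp add: B_def)
    have Bt: "transpose_mat B = B"
      unfolding B_def using H A At
      by (simp add: transpose_mult[of _ ?n ?n _ ?n] assoc_mult_mat[of _ ?n ?n _ ?n _ ?n])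
    have B0: "B $$ (i, 0) = (if i = 0 then k else 0)" if i: "i < ?n" for i
    proof -
      have "B $$ (i, 0) = scalar_prod (col H i) (A *\<^sub>v v)"
        using H A i Hv by (simp add: B_def assoc_mult_mat[of _ ?n ?n _ ?n _ ?n])
      also have "\<dots> = k * scalar_prod (col H i) (col H 0)"
        using Hv H i v by (simp add: Av)
      also have "scalar_prod (col H i) (col H 0) = (transpose_mat H * H) $$ (i, 0)"
        using H i by simp
      finally show ?thesis using i by (simp add: HH)
    qed
    have B0': "B $$ (0, j) = (if j = 0 then k else 0)" if j: "j < ?n" for j
      using B0[OF j] Bt B j by (metis index_transpose_mat(1) carrier_matD zero_less_Suc)
    define C where "C = mat n n (\<lambda>(i, j). B $$ (Suc i, Suc j))"
    have C: "C \<in> sym_mats n"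
    proof -
      have "B $$ (Suc j, Suc i) = B $$ (Suc i, Suc j)" if "i < n" "j < n" for i j
        using arg_cong[OF Bt, of "\<lambda>M. M $$ (Suc i, Suc j)"] B that by simp
      then show ?thesis by (auto simp: sym_mats_def C_def intro!: eq_matI)
    qed
    then have Cc: "C \<in> carrier_mat n n" by (simp add: sym_mats_def)
    have Bblock: "B = four_block_mat (mat 1 1 (\<lambda>_. k)) (0\<^sub>m 1 n) (0\<^sub>m n 1) C"
      by (rule eq_matI) (use B B0 B0' in \<open>auto simp: C_def\<close>)
    obtain P m where P: "P \<in> carrier_mat n n" "transpose_mat P * P = 1\<^sub>m n"
      "transpose_mat P * C * P = mat_diag n m"
      using Suc.IH[OF C] by blast
    define R where "R = four_block_mat (1\<^sub>m 1) (0\<^sub>m 1 n) (0\<^sub>m n 1) P"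
    have R: "R \<in> carrier_mat ?n ?n" using P four_block_carrier_mat[of "1\<^sub>m 1" 1 1 P n n] by (simp add: R_def)
    have Rt: "transpose_mat R = four_block_mat (1\<^sub>m 1) (0\<^sub>m 1 n) (0\<^sub>m n 1) (transpose_mat P)"
      unfolding R_def using P by (subst transpose_four_block_mat[of _ 1 1 _ n _ n]) auto
    have RR: "transpose_mat R * R = 1\<^sub>m ?n"
      unfolding Rt unfolding R_def using P
      by (subst mult_four_block_mat[of _ 1 1 _ n _ n _ _ 1 _ n]) auto
    have RBR: "transpose_mat R * B * R = four_block_mat (mat 1 1 (\<lambda>_. k)) (0\<^sub>m 1 n) (0\<^sub>m n 1) (mat_diag n m)"
      unfolding Rt Bblock unfolding R_def using P Cc
      by (subst mult_four_block_mat[of _ 1 1 _ n _ n _ _ 1 _ n], auto)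
        (subst mult_four_block_mat[of _ 1 1 _ n _ n _ _ 1 _ n], auto)
    have diag: "four_block_mat (mat 1 1 (\<lambda>_. k)) (0\<^sub>m 1 n) (0\<^sub>m n 1) (mat_diag n m)
        = mat_diag ?n (case_nat k m)"
      by (rule eq_matI) (auto simp: mat_diag_def split: nat.splits)
    define Q where "Q = H * R"
    have "transpose_mat Q * Q = transpose_mat R * (transpose_mat H * H) * R"
      unfolding Q_def using H R
      by (simp add: transpose_mult[of _ ?n ?n _ ?n] assoc_mult_mat[of _ ?n ?n _ ?n _ ?n])
    then have "transpose_mat Q * Q = 1\<^sub>m ?n" using RR R by (simp add: HH)
    moreover have "transpose_mat Q * A * Q = transpose_mat R * B * R"
      unfolding Q_def B_def using H R A
      by (simp add: transpose_mult[of _ ?n ?n _ ?n] assoc_mult_mat[of _ ?n ?n _ ?n _ ?n])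
    moreover have "Q \<in> carrier_mat ?n ?n" using H R by (simp add: Q_def)
    ultimately show ?case using RBR diag by metis
  qed
  then obtain Q l where Q: "Q \<in> carrier_mat n n" "transpose_mat Q * Q = 1\<^sub>m n"
    and D: "transpose_mat Q * A * Q = mat_diag n l" by blast
  have A: "A \<in> carrier_mat n n" using assms by (simp add: sym_mats_def)
  have QQ: "Q * transpose_mat Q = 1\<^sub>m n"
    using mat_mult_left_right_inverse[OF _ Q(1) Q(2)] Q(1) by simp
  have "Q * mat_diag n l * transpose_mat Q = (Q * transpose_mat Q) * A * (Q * transpose_mat Q)"
    unfolding D[symmetric] using Q(1) A by (simp add: assoc_mult_mat[of _ n n _ n _ n])
  then have "A = Q * mat_diag n l * transpose_mat Q" using A by (simp add: QQ)
  with Q that show ?thesis by blast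
qed

section \<open>The logarithmic derivative of the determinant\<close>

text \<open>
  Jacobi's formula at a diagonal matrix, read off the Leibniz expansion: a permutation other than
  the identity moves at least two indices, so after one factor has been differentiated there is
  still an off-diagonal factor, which vanishes at \<open>s = 0\<close>.
\<close>

lemma has_field_derivative_det_mat_diag:
  fixes V :: "real mat"
  assumes V: "V \<in> carrier_mat n n"
  shows "((\<lambda>s. det (mat_diag n m + s \<cdot>\<^sub>m V)) has_field_derivative
    (\<Sum>i\<in>{0..<n}. V $$ (i, i) * (\<Prod>j\<in>{0..<n} - {i}. m j))) (at 0)"
proof -
  let ?S = "{0..<n}"
  let ?D = "\<lambda>i j. if i = j then m j else 0"
  let ?P = "{p. p permutes ?S}"
  let ?d = "\<lambda>p. signof p * (\<Sum>i\<in>?S. V $$ (i, p i) * (\<Prod>j\<in>?S - {i}. ?D j (p j)))"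
  have det: "det (mat_diag n m + s \<cdot>\<^sub>m V) = (\<Sum>p\<in>?P. signof p * (\<Prod>i\<in>?S. ?D i (p i) + s * V $$ (i, p i)))" for s
  proof -
    have "mat_diag n m + s \<cdot>\<^sub>m V \<in> carrier_mat n n" using V by simp
    then show ?thesis
      by (subst det_def'[of _ n])
        (use V in \<open>auto intro!: sum.cong prod.cong simp: mat_diag_def permutes_in_image[where S = ?S, simplified]\<close>)
  qed
  have "((\<lambda>s. \<Sum>p\<in>?P. signof p * (\<Prod>i\<in>?S. ?D i (p i) + s * V $$ (i, p i))) has_field_derivative
      (\<Sum>p\<in>?P. ?d p)) (at 0)"
    by (rule DERIV_sum, rule DERIV_cmult, rule has_field_derivative_prod[THEN DERIV_cong])
      (auto intro!: derivative_eq_intros)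
  also have "(\<Sum>p\<in>?P. ?d p) = (\<Sum>p\<in>{id}. ?d p)"
  proof (rule sum.mono_neutral_right)
    show "\<forall>p\<in>?P - {id}. ?d p = 0"
    proof
      fix p assume "p \<in> ?P - {id}"
      then have p: "p permutes ?S" and "p \<noteq> id" by auto
      then obtain a where a: "p a \<noteq> a" by (auto simp: fun_eq_iff)
      have aS: "a \<in> ?S" using a permutes_not_in[OF p] by blast
      have "(\<Prod>j\<in>?S - {i}. ?D j (p j)) = 0" for i
      proof -
        have "\<exists>j\<in>?S - {i}. p j \<noteq> j"
        proof (cases "a = i")
          case True
          have "p a \<in> ?S - {i}" using a True aS permutes_in_image[OF p] by auto
          moreover have "p (p a) \<noteq> p a" using a permutes_inj[OF p] by (meson injD)
          ultimately show ?thesis by blast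
        qed (use a aS in auto)
        then show ?thesis by (metis (mono_tags, lifting) finite_Diff finite_atLeastLessThan prod_zero)
      qed
      then show "?d p = 0" by (simp only: mult_zero_right sum.neutral_const)
    qed
  qed (auto simp: finite_permutations permutes_id)
  also have "(\<Sum>p\<in>{id}. ?d p) = (\<Sum>i\<in>?S. V $$ (i, i) * (\<Prod>j\<in>?S - {i}. m j))"
    by simp
  finally show ?thesis unfolding det .
qed

lemma det_mat_diag: "det (mat_diag n m) = (\<Prod>i\<in>{0..<n}. m i)" for m :: "nat \<Rightarrow> 'a::comm_ring_1"
  by (subst det_upper_triangular[of _ n]) (auto simp: mat_diag_def prod_list_diag_prod)

lemma det_orthogonal_conjugate:
  fixes Q :: "real mat"
  assumes Q: "Q \<in> carrier_mat n n" "transpose_mat Q * Q = 1\<^sub>m n" and M: "M \<in> carrier_mat n n"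
  shows "det (Q * M * transpose_mat Q) = det M"
proof -
  have "det (transpose_mat Q) * det Q = 1"
    using det_mult[of "transpose_mat Q" n Q] Q by simp
  then show ?thesis
    using Q M by (simp add: det_mult[of _ n] mult.commute mult.left_commute)
qed

lemma orthogonal_mat_right_inverse:
  fixes Q :: "real mat"
  assumes "Q \<in> carrier_mat n n" "transpose_mat Q * Q = 1\<^sub>m n"
  shows "Q * transpose_mat Q = 1\<^sub>m n"
  using mat_mult_left_right_inverse[OF _ assms(1) assms(2)] assms(1) by simp

lemma orthogonal_conjugate_cancel:
  fixes Q :: "real mat"
  assumes Q: "Q \<in> carrier_mat n n" "transpose_mat Q * Q = 1\<^sub>m n" and M: "M \<in> carrier_mat n n"
  shows "Q * (transpose_mat Q * M * Q) * transpose_mat Q = M"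
    "transpose_mat Q * (Q * M * transpose_mat Q) * Q = M"
proof -
  have "Q * (transpose_mat Q * M * Q) * transpose_mat Q = (Q * transpose_mat Q) * M * (Q * transpose_mat Q)"
    using Q(1) M by (simp add: assoc_mult_mat[of _ n n _ n _ n])
  then show "Q * (transpose_mat Q * M * Q) * transpose_mat Q = M"
    using M orthogonal_mat_right_inverse[OF Q] by simp
  have "transpose_mat Q * (Q * M * transpose_mat Q) * Q = (transpose_mat Q * Q) * M * (transpose_mat Q * Q)"
    using Q(1) M by (simp add: assoc_mult_mat[of _ n n _ n _ n])
  then show "transpose_mat Q * (Q * M * transpose_mat Q) * Q = M"
    using M Q by simp
qed

lemma shifted_pencil_diagonalization:
  fixes Q :: "real mat"
  assumes Q: "Q \<in> carrier_mat n n" "transpose_mat Q * Q = 1\<^sub>m n" and U: "U \<in> carrier_mat n n"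
  shows "Q * mat_diag n l * transpose_mat Q + t \<cdot>\<^sub>m 1\<^sub>m n + s \<cdot>\<^sub>m U =
    Q * (mat_diag n (\<lambda>i. l i + t) + s \<cdot>\<^sub>m (transpose_mat Q * U * Q)) * transpose_mat Q"
proof -
  have D: "mat_diag n (\<lambda>i. l i + t) = mat_diag n l + t \<cdot>\<^sub>m 1\<^sub>m n"
    by (rule eq_matI) (auto simp: mat_diag_def)
  have 1: "Q * (t \<cdot>\<^sub>m 1\<^sub>m n) * transpose_mat Q = t \<cdot>\<^sub>m 1\<^sub>m n"
    using Q orthogonal_mat_right_inverse[OF Q]
    by (simp add: mult_smult_distrib[of _ n n _ n] mult_smult_assoc_mat[of _ n n _ n])
  have 2: "Q * (s \<cdot>\<^sub>m (transpose_mat Q * U * Q)) * transpose_mat Q = s \<cdot>\<^sub>m U"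
    using Q U orthogonal_conjugate_cancel(1)[OF Q U]
    by (simp add: mult_smult_distrib[of _ n n _ n] mult_smult_assoc_mat[of _ n n _ n])
  define W where "W = s \<cdot>\<^sub>m (transpose_mat Q * U * Q)"
  have W: "W \<in> carrier_mat n n" using Q U by (simp add: W_def)
  show ?thesis
    unfolding D W_def[symmetric] using Q W 2
    by (simp add: mult_add_distrib_mat[of _ n n _ n] add_mult_distrib_mat[of _ n n _ _ n] 1 W_def[symmetric])
qed

lemma log_derivative_det:
  fixes Q :: "real mat"
  assumes Q: "Q \<in> carrier_mat n n" "transpose_mat Q * Q = 1\<^sub>m n" and U: "U \<in> carrier_mat n n"
    and X: "X = Q * mat_diag n l * transpose_mat Q"
    and t: "\<And>i. i < n \<Longrightarrow> l i + t \<noteq> 0"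
  shows "directional_deriv U det (X + t \<cdot>\<^sub>m 1\<^sub>m n) / det (X + t \<cdot>\<^sub>m 1\<^sub>m n) =
    (\<Sum>i\<in>{0..<n}. (transpose_mat Q * U * Q) $$ (i, i) / (l i + t))"
proof -
  define V where "V = transpose_mat Q * U * Q"
  have V: "V \<in> carrier_mat n n" using Q U by (simp add: V_def)
  have det: "det (X + t \<cdot>\<^sub>m 1\<^sub>m n + s \<cdot>\<^sub>m U) = det (mat_diag n (\<lambda>i. l i + t) + s \<cdot>\<^sub>m V)" for s
    unfolding X shifted_pencil_diagonalization[OF Q U] V_def[symmetric]
    by (rule det_orthogonal_conjugate[OF Q]) (use V in simp)
  have "directional_deriv U det (X + t \<cdot>\<^sub>m 1\<^sub>m n) =
      (\<Sum>i\<in>{0..<n}. V $$ (i, i) * (\<Prod>j\<in>{0..<n} - {i}. l j + t))"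
    unfolding directional_deriv_def det
    by (rule DERIV_imp_deriv, rule has_field_derivative_det_mat_diag[OF V])
  moreover have "det (X + t \<cdot>\<^sub>m 1\<^sub>m n) = (\<Prod>j\<in>{0..<n}. l j + t)"
  proof -
    have "X + t \<cdot>\<^sub>m 1\<^sub>m n + 0 \<cdot>\<^sub>m U = X + t \<cdot>\<^sub>m 1\<^sub>m n"
      "mat_diag n (\<lambda>i. l i + t) + 0 \<cdot>\<^sub>m V = mat_diag n (\<lambda>i. l i + t)"
      using U V Q by (auto intro!: eq_matI simp: X mat_diag_def)
    then have "det (X + t \<cdot>\<^sub>m 1\<^sub>m n) = det (mat_diag n (\<lambda>i. l i + t))"
      using det[of 0] by simp
    then show ?thesis by (simp add: det_mat_diag)
  qed
  moreover have "V $$ (i, i) * (\<Prod>j\<in>{0..<n} - {i}. l j + t) / (\<Prod>j\<in>{0..<n}. l j + t) = V $$ (i, i) / (l i + t)"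
    if "i < n" for i
  proof -
    have "(\<Prod>j\<in>{0..<n}. l j + t) = (l i + t) * (\<Prod>j\<in>{0..<n} - {i}. l j + t)"
      using that by (subst prod.remove[of _ i]) auto
    moreover have "(\<Prod>j\<in>{0..<n} - {i}. l j + t) \<noteq> 0" using t by auto
    ultimately show ?thesis using t[OF that] by simp
  qed
  ultimately show ?thesis
    by (simp add: sum_divide_distrib V_def)
qed

section \<open>Expansion at infinity and the Hermite matrix\<close>

text \<open>
  Substituting \<open>x = 1 / t\<close> turns the difference of the two expansions into a power series
  vanishing on a punctured neighbourhood of \<open>0\<close>; its coefficients are zero one after another.
  This is the uniqueness that the definite description in \<^const>\<open>hermite_coeff\<close> needs.
\<close>

lemma coefficients_at_infinity_unique:
  fixes a b :: "nat \<Rightarrow> real"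
  assumes a: "\<forall>\<^sub>F t in at_infinity. (\<lambda>k. a k / t ^ k) sums f t"
    and b: "\<forall>\<^sub>F t in at_infinity. (\<lambda>k. b k / t ^ k) sums f t"
  shows "a = b"
proof -
  define c where "c k = a k - b k" for k
  have "\<forall>\<^sub>F t in at_infinity. (\<lambda>k. c k / t ^ k) sums 0"
    using eventually_conj[OF a b]
  proof (rule eventually_mono)
    fix t assume "(\<lambda>k. a k / t ^ k) sums f t \<and> (\<lambda>k. b k / t ^ k) sums f t"
    then have "(\<lambda>k. a k / t ^ k - b k / t ^ k) sums (f t - f t)" by (intro sums_diff) auto
    then show "(\<lambda>k. c k / t ^ k) sums 0" by (simp add: c_def diff_divide_distrib)
  qed
  then obtain r where r: "\<And>t. r \<le> \<bar>t\<bar> \<Longrightarrow> (\<lambda>k. c k / t ^ k) sums 0"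
    by (auto simp: eventually_at_infinity)
  \<comment> \<open>\<open>r\<close> may be negative or zero, hence the choice of radius.\<close>
  define e where "e = 1 / (1 + \<bar>r\<bar>)"
  have e: "0 < e" by (simp add: e_def add_pos_nonneg)
  have small: "(\<lambda>k. c k * x ^ k) sums 0" if "x \<noteq> 0" "\<bar>x\<bar> < e" for x
  proof -
    have "1 + \<bar>r\<bar> < 1 / \<bar>x\<bar>" using that by (simp add: e_def field_simps)
    then have "r \<le> \<bar>1 / x\<bar>" by simp
    from r[OF this] show ?thesis by (simp add: power_one_over divide_inverse power_inverse)
  qed
  have "c k = 0" for k
  proof (induction k rule: less_induct)
    case (less m)
    have "(\<lambda>k. c (k + m) * x ^ k) sums 0" if x: "x \<noteq> 0" "norm x < e" for x
    proof -
      have "(\<Sum>k<m. c k * x ^ k) = 0" using less by simp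
      then have "(\<lambda>k. c (k + m) * x ^ (k + m)) sums 0"
        using sums_split_initial_segment[OF small[of x], of m] x by simp
      then have "(\<lambda>k. x ^ m * (c (k + m) * x ^ k)) sums (x ^ m * 0)"
        by (simp add: power_add mult_ac)
      then show ?thesis using x by (subst (asm) sums_mult_iff) simp_all
    qed
    \<comment> \<open>The shifted series represents \<open>0\<close> near \<open>0\<close>, and its limit there is its constant term.\<close>
    from powser_limit_0_strong[OF e this]
    have "((\<lambda>x::real. 0) \<longlongrightarrow> c m) (at 0)" by simp
    then show ?case by (simp add: tendsto_const_iff)
  qed
  then show ?thesis by (auto simp: c_def)
qed

lemma inverse_shift_expansion:
  fixes a l t :: real
  assumes "\<bar>l\<bar> < \<bar>t\<bar>"
  shows "(\<lambda>k. (if k = 0 then 0 else a * (- l) ^ (k - 1)) / t ^ k) sums (a / (l + t))"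
proof -
  have t: "t \<noteq> 0" "l + t \<noteq> 0" using assms by auto
  have "norm (- l / t) < 1" using assms t by (simp add: field_simps)
  from sums_mult[OF geometric_sums[OF this], of "a / t"]
  have "(\<lambda>k. a / t * (- l / t) ^ k) sums (a / t * (1 / (1 - - l / t)))" .
  also have "(\<lambda>k. a / t * (- l / t) ^ k) = (\<lambda>k. a * (- l) ^ k / t ^ Suc k)"
    by (simp only: power_divide times_divide_times_eq power_Suc)
  also have "a / t * (1 / (1 - - l / t)) = a / (l + t)"
    using t by (simp add: field_simps)
  finally have "(\<lambda>k. (if Suc k = 0 then 0 else a * (- l) ^ (Suc k - 1)) / t ^ Suc k) sums (a / (l + t))"
    by simp
  from sums_Suc[OF this] show ?thesis by simp
qed

lemma hermite_coeff_det:
  fixes Q :: "real mat"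
  assumes Q: "Q \<in> carrier_mat n n" "transpose_mat Q * Q = 1\<^sub>m n" and U: "U \<in> carrier_mat n n"
    and X: "X = Q * mat_diag n l * transpose_mat Q"
  shows "hermite_coeff det (1\<^sub>m n) X U (Suc k) =
    (\<Sum>i\<in>{0..<n}. (transpose_mat Q * U * Q) $$ (i, i) * (- l i) ^ k)"
proof -
  define V where "V = transpose_mat Q * U * Q"
  define h where "h k = (\<Sum>i\<in>{0..<n}. if k = 0 then 0 else V $$ (i, i) * (- l i) ^ (k - 1))" for k :: nat
  let ?f = "\<lambda>t. directional_deriv U det (X + t \<cdot>\<^sub>m 1\<^sub>m n) / det (X + t \<cdot>\<^sub>m 1\<^sub>m n)"
  have ev: "\<forall>\<^sub>F t in at_infinity. (\<lambda>k. h k / t ^ k) sums ?f t"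
    unfolding eventually_at_infinity
  proof (intro exI allI impI)
    fix t :: real
    assume t: "1 + (\<Sum>i\<in>{0..<n}. \<bar>l i\<bar>) \<le> norm t"
    \<comment> \<open>The bound on \<open>t\<close> exceeds every \<open>\<bar>l i\<bar>\<close>, so all geometric series converge.\<close>
    have less: "\<bar>l i\<bar> < \<bar>t\<bar>" if "i < n" for i
      using member_le_sum[of i "{0..<n}" "\<lambda>i. \<bar>l i\<bar>"] that t by auto
    then have "?f t = (\<Sum>i\<in>{0..<n}. V $$ (i, i) / (l i + t))"
      unfolding V_def by (intro log_derivative_det[OF Q U X]) fastforce
    moreover have "(\<lambda>k. \<Sum>i\<in>{0..<n}. (if k = 0 then 0 else V $$ (i, i) * (- l i) ^ (k - 1)) / t ^ k) sums
        (\<Sum>i\<in>{0..<n}. V $$ (i, i) / (l i + t))"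
      by (rule sums_sum) (use less in \<open>auto intro: inverse_shift_expansion\<close>)
    ultimately show "(\<lambda>k. h k / t ^ k) sums ?f t"
      by (simp only: h_def sum_divide_distrib)
  qed
  have "hermite_coeff det (1\<^sub>m n) X U = h"
    unfolding hermite_coeff_def
  proof (rule the_equality)
    show "h 0 = 0 \<and> (\<forall>\<^sub>F t in at_infinity. (\<lambda>k. h k / t ^ k) sums ?f t)"
      using ev by (simp add: h_def)
    show "h' = h" if "h' 0 = 0 \<and> (\<forall>\<^sub>F t in at_infinity. (\<lambda>k. h' k / t ^ k) sums ?f t)" for h'
      using coefficients_at_infinity_unique[of h' ?f h] that ev by simp
  qed
  then show ?thesis by (simp add: h_def V_def)
qed

text \<open>
  The Hermite form is a weighted sum of squares of values of the polynomial with coefficient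
  vector \<open>y\<close>.
\<close>

lemma hermite_mat_quadratic_form:
  fixes Q :: "real mat"
  assumes Q: "Q \<in> carrier_mat n n" "transpose_mat Q * Q = 1\<^sub>m n" and U: "U \<in> carrier_mat n n"
    and X: "X = Q * mat_diag n l * transpose_mat Q" and y: "y \<in> carrier_vec n"
  shows "scalar_prod y (hermite_mat n det (1\<^sub>m n) X U *\<^sub>v y) =
    (\<Sum>i\<in>{0..<n}. (transpose_mat Q * U * Q) $$ (i, i) * (\<Sum>k\<in>{0..<n}. y $ k * (- l i) ^ k)\<^sup>2)"
proof -
  let ?S = "{0..<n}"
  define v where "v i = (transpose_mat Q * U * Q) $$ (i, i)" for i
  have "scalar_prod y (hermite_mat n det (1\<^sub>m n) X U *\<^sub>v y) =
      (\<Sum>j\<in>?S. \<Sum>k\<in>?S. \<Sum>i\<in>?S. v i * ((y $ j * (- l i) ^ j) * (y $ k * (- l i) ^ k)))"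
    using y by (simp add: scalar_prod_def hermite_mat_def hermite_coeff_det[OF Q U X] v_def
        sum_distrib_left sum_distrib_right power_add mult_ac)
  also have "\<dots> = (\<Sum>j\<in>?S. \<Sum>i\<in>?S. \<Sum>k\<in>?S. v i * ((y $ j * (- l i) ^ j) * (y $ k * (- l i) ^ k)))"
    by (rule sum.cong[OF refl], rule sum.swap)
  also have "\<dots> = (\<Sum>i\<in>?S. \<Sum>j\<in>?S. \<Sum>k\<in>?S. v i * ((y $ j * (- l i) ^ j) * (y $ k * (- l i) ^ k)))"
    by (rule sum.swap)
  also have "\<dots> = (\<Sum>i\<in>?S. v i * (\<Sum>k\<in>?S. y $ k * (- l i) ^ k)\<^sup>2)"
    by (simp only: power2_eq_square sum_product) (simp only: sum_distrib_left)
  finally show ?thesis by (simp add: v_def)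
qed

section \<open>The hyperbolicity cone of the determinant\<close>

lemma index_mult_mat_transpose:
  fixes Q :: "real mat"
  assumes "Q \<in> carrier_mat n n" "U \<in> carrier_mat n n" "i < n" "j < n"
  shows "(transpose_mat Q * U * Q) $$ (i, j) =
    (\<Sum>k\<in>{0..<n}. \<Sum>l\<in>{0..<n}. Q $$ (k, i) * U $$ (k, l) * Q $$ (l, j))"
proof -
  have "(transpose_mat Q * U * Q) $$ (i, j) = (transpose_mat Q * (U * Q)) $$ (i, j)"
    using assms by (simp add: assoc_mult_mat[of _ n n _ n _ n])
  also have "\<dots> = (\<Sum>k\<in>{0..<n}. Q $$ (k, i) * (\<Sum>l\<in>{0..<n}. U $$ (k, l) * Q $$ (l, j)))"
    using assms by (simp add: scalar_prod_def del: assoc_mult_mat)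
  finally show ?thesis by (simp add: sum_distrib_left mult.assoc)
qed

lemma index_mat_diag_conjugate:
  fixes Q :: "real mat"
  assumes "Q \<in> carrier_mat n n" "i < n" "j < n"
  shows "(Q * mat_diag n l * transpose_mat Q) $$ (i, j) = (\<Sum>k\<in>{0..<n}. l k * (Q $$ (i, k) * Q $$ (j, k)))"
  using assms by (simp add: mat_diag_mult_right[of _ n] scalar_prod_def mult_ac)

lemma sym_mats_add: "A \<in> sym_mats n \<Longrightarrow> B \<in> sym_mats n \<Longrightarrow> A + B \<in> sym_mats n"
  by (auto simp: sym_mats_def transpose_add)

lemma sym_mats_smult:
  assumes "A \<in> sym_mats n"
  shows "c \<cdot>\<^sub>m A \<in> sym_mats n"
proof -
  have "transpose_mat (c \<cdot>\<^sub>m A) = c \<cdot>\<^sub>m transpose_mat A" by (rule eq_matI) auto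
  with assms show ?thesis by (simp add: sym_mats_def)
qed

lemma mat_diag_conjugate_sym_mats:
  fixes Q :: "real mat"
  assumes "Q \<in> carrier_mat n n"
  shows "Q * mat_diag n l * transpose_mat Q \<in> sym_mats n"
  unfolding sym_mats_def
  using assms by (auto intro!: eq_matI simp: index_mat_diag_conjugate mult.commute simp del: index_mult_mat(1))

text \<open>
  Together with the spectral theorem: the cone consists of the positive semidefinite matrices.
\<close>

lemma mat_diag_conjugate_in_cone_iff:
  fixes Q :: "real mat"
  assumes Q: "Q \<in> carrier_mat n n" "transpose_mat Q * Q = 1\<^sub>m n"
  shows "Q * mat_diag n l * transpose_mat Q \<in> hyperbolicity_cone (sym_mats n) det (1\<^sub>m n) \<longleftrightarrow>
    (\<forall>i<n. 0 \<le> l i)"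
proof -
  let ?X = "Q * mat_diag n l * transpose_mat Q"
  have "det (t \<cdot>\<^sub>m 1\<^sub>m n - ?X) = (\<Prod>i\<in>{0..<n}. t - l i)" for t
  proof -
    have "Q * mat_diag n (\<lambda>_. t) * transpose_mat Q = t \<cdot>\<^sub>m 1\<^sub>m n"
    proof -
      have "mat_diag n (\<lambda>_. t) = t \<cdot>\<^sub>m 1\<^sub>m n" by (rule eq_matI) (auto simp: mat_diag_def)
      then show ?thesis
        using Q orthogonal_mat_right_inverse[OF Q]
        by (simp add: mult_smult_distrib[of _ n n _ n] mult_smult_assoc_mat[of _ n n _ n])
    qed
    moreover have "Q * mat_diag n (\<lambda>_. t) * transpose_mat Q - ?X = Q * mat_diag n (\<lambda>i. t - l i) * transpose_mat Q"
      by (rule eq_matI)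
        (use Q(1) in \<open>auto simp: index_mat_diag_conjugate sum_subtractf left_diff_distrib simp del: index_mult_mat(1)\<close>)
    ultimately show ?thesis using det_orthogonal_conjugate[OF Q, of "mat_diag n (\<lambda>i. t - l i)"]
      by (simp add: det_mat_diag)
  qed
  then have "det (t \<cdot>\<^sub>m 1\<^sub>m n - ?X) = 0 \<longleftrightarrow> (\<exists>i<n. t = l i)" for t
    by auto
  then have "?X \<in> hyperbolicity_cone (sym_mats n) det (1\<^sub>m n) \<longleftrightarrow> (\<forall>t. (\<exists>i<n. t = l i) \<longrightarrow> 0 \<le> t)"
    using mat_diag_conjugate_sym_mats[OF Q(1), of l] by (simp add: hyperbolicity_cone_def)
  then show ?thesis by blast
qed

text \<open>
  No orthogonality of \<open>Q\<close> is needed: \<open>U = P diag(l) P\<^sup>T\<close> with \<open>l \<ge> 0\<close> gives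
  \<open>Q\<^sup>T U Q = R diag(l) R\<^sup>T\<close> with \<open>R = Q\<^sup>T P\<close>, whose diagonal entries are sums of
  \<open>l k (R i k)\<^sup>2\<close>.
\<close>

lemma hyperbolicity_cone_diagonal_nonneg:
  assumes U: "U \<in> hyperbolicity_cone (sym_mats n) det (1\<^sub>m n)"
    and Q: "Q \<in> carrier_mat n n" and i: "i < n"
  shows "0 \<le> (transpose_mat Q * U * Q) $$ (i, i)"
proof -
  have "U \<in> sym_mats n" using U by (simp add: hyperbolicity_cone_def)
  then obtain P l where P: "P \<in> carrier_mat n n" "transpose_mat P * P = 1\<^sub>m n"
    and UP: "U = P * mat_diag n l * transpose_mat P"
    by (rule spectral_theorem_sym_mats)
  have l: "\<forall>i<n. 0 \<le> l i" using U mat_diag_conjugate_in_cone_iff[OF P] by (simp add: UP)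
  define R where "R = transpose_mat Q * P"
  have R: "R \<in> carrier_mat n n" using P Q by (simp add: R_def)
  have "transpose_mat Q * U * Q = R * mat_diag n l * transpose_mat R"
    unfolding R_def UP using P Q
    by (simp add: transpose_mult[of _ n n _ n] assoc_mult_mat[of _ n n _ n _ n] mult_carrier_mat[of _ n n _ n])
  then show ?thesis
    using R i l by (auto simp: index_mat_diag_conjugate intro!: sum_nonneg simp del: index_mult_mat(1))
qed

section \<open>Functionals on symmetric matrices\<close>

text \<open>
  Additivity extends to finite linear combinations; these are written entrywise because
  \<^typ>\<open>real mat\<close>, comprising matrices of all sizes, has no zero for \<^const>\<open>sum\<close> to start from.
\<close>

lemma dual_space_sum:
  assumes \<xi>: "\<xi> \<in> dual_space (sym_mats n)" and F: "finite F" and S: "\<And>p. p \<in> F \<Longrightarrow> S p \<in> sym_mats n"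
  shows "\<xi> (mat n n (\<lambda>ij. \<Sum>p\<in>F. c p * S p $$ ij)) = (\<Sum>p\<in>F. c p * \<xi> (S p))"
proof -
  have add: "\<xi> (X + Y) = \<xi> X + \<xi> Y" if "X \<in> sym_mats n" "Y \<in> sym_mats n" for X Y
    using \<xi> that by (auto simp: dual_space_def)
  have smult: "\<xi> (c \<cdot>\<^sub>m X) = c * \<xi> X" if "X \<in> sym_mats n" for c X
    using \<xi> that by (auto simp: dual_space_def)
  let ?M = "\<lambda>F. mat n n (\<lambda>ij. \<Sum>p\<in>F. c p * S p $$ ij)"
  have M: "?M G \<in> sym_mats n" if "G \<subseteq> F" for G
  proof -
    have "(\<Sum>p\<in>G. c p * S p $$ (j, i)) = (\<Sum>p\<in>G. c p * S p $$ (i, j))" if "i < n" "j < n" for i j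
    proof (rule sum.cong[OF refl])
      fix p assume "p \<in> G"
      with \<open>G \<subseteq> F\<close> have "S p \<in> sym_mats n" using S by blast
      from sym_mats_index_commute[OF this that]
      show "c p * S p $$ (j, i) = c p * S p $$ (i, j)" by simp
    qed
    then show ?thesis by (auto simp: sym_mats_def intro!: eq_matI)
  qed
  have "\<xi> (?M G) = (\<Sum>p\<in>G. c p * \<xi> (S p))" if "finite G" "G \<subseteq> F" for G
    using that
  proof (induction G)
    case empty
    have "?M {} = 0 \<cdot>\<^sub>m ?M {}" by (rule eq_matI) auto
    moreover have "\<xi> (0 \<cdot>\<^sub>m ?M {}) = 0"
      unfolding smult[OF M[OF empty_subsetI]] by (rule mult_zero_left)
    ultimately have "\<xi> (?M {}) = 0" by (rule arg_cong[of _ _ \<xi>, THEN trans])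
    then show ?case by simp
  next
    case (insert p G)
    then have p: "S p \<in> sym_mats n" using S by simp
    then have "?M (insert p G) = c p \<cdot>\<^sub>m S p + ?M G" using insert.hyps
      by (intro eq_matI) (auto simp: sym_mats_def)
    moreover have "c p \<cdot>\<^sub>m S p \<in> sym_mats n" using p by (rule sym_mats_smult)
    ultimately show ?case using add[OF _ M[of G]] smult[OF p] insert by simp
  qed
  from this[OF F] show "\<xi> (?M F) = (\<Sum>p\<in>F. c p * \<xi> (S p))" by simp
qed

text \<open>
  The spanning set used is \<open>S (i, j) = E\<^sub>i\<^sub>j + E\<^sub>j\<^sub>i\<close> with \<open>E\<^sub>i\<^sub>j\<close> the matrix units; the sum
  of \<open>U i j S (i, j)\<close> over all ordered pairs \<open>(i, j)\<close> is \<open>2 U\<close>, which accounts for the factors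
  \<open>1 / 2\<close>.
\<close>

lemma dual_space_sym_mats_trace_form:
  assumes \<xi>: "\<xi> \<in> dual_space (sym_mats n)"
  obtains A where "A \<in> sym_mats n"
    "\<And>U. U \<in> sym_mats n \<Longrightarrow> \<xi> U = (\<Sum>i\<in>{0..<n}. \<Sum>j\<in>{0..<n}. A $$ (i, j) * U $$ (i, j))"
proof -
  let ?I = "{0..<n} \<times> {0..<n}"
  define S :: "nat \<times> nat \<Rightarrow> real mat"
    where "S = (\<lambda>(i, j). mat n n (\<lambda>kl. of_bool (kl = (i, j)) + of_bool (kl = (j, i))))"
  have S: "S p \<in> sym_mats n" for p
  proof -
    obtain i j where p: "p = (i, j)" by (cases p)
    have "S p $$ (l, k) = S p $$ (k, l)" if "k < n" "l < n" for k l
    proof -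
      have "(l, k) = (i, j) \<longleftrightarrow> (k, l) = (j, i)" "(l, k) = (j, i) \<longleftrightarrow> (k, l) = (i, j)" by blast+
      then show ?thesis using that by (simp add: S_def p del: prod.inject)
    qed
    moreover have "S p \<in> carrier_mat n n" by (simp add: S_def p)
    ultimately show ?thesis by (auto simp: sym_mats_def intro!: eq_matI)
  qed
  have S_commute: "S (j, i) = S (i, j)" for i j
    unfolding S_def split by (subst add.commute) (rule refl)
  define A where "A = mat n n (\<lambda>p. \<xi> (S p) / 2)"
  have "transpose_mat A = A"
  proof (rule eq_matI)
    fix i j assume "i < dim_row A" "j < dim_col A"
    then show "transpose_mat A $$ (i, j) = A $$ (i, j)"
      using S_commute[of i j] by (simp add: A_def)
  qed (simp_all add: A_def)
  then have A: "A \<in> sym_mats n" by (simp add: sym_mats_def A_def)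
  have "\<xi> U = (\<Sum>i\<in>{0..<n}. \<Sum>j\<in>{0..<n}. A $$ (i, j) * U $$ (i, j))" if U: "U \<in> sym_mats n" for U
  proof -
    have c: "U \<in> carrier_mat n n" using U by (simp add: sym_mats_def)
    have "U = mat n n (\<lambda>kl. \<Sum>p\<in>?I. U $$ p / 2 * S p $$ kl)"
    proof (rule eq_matI, goal_cases)
      case (1 k l)
      then have k: "k < n" and l: "l < n" by auto
      have "S p $$ (k, l) = of_bool (p = (k, l)) + of_bool (p = (l, k))" for p
      proof -
        obtain i j where p: "p = (i, j)" by (cases p)
        have "(k, l) = (i, j) \<longleftrightarrow> p = (k, l)" "(k, l) = (j, i) \<longleftrightarrow> p = (l, k)"
          unfolding p by blast+
        then show ?thesis using k l by (simp add: S_def p del: prod.inject)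
      qed
      moreover have "x * (of_bool a + of_bool b) = (if a then x else 0) + (if b then x else 0)"
        for x :: real and a b by simp
      ultimately have "(\<Sum>p\<in>?I. U $$ p / 2 * S p $$ (k, l)) =
          (\<Sum>p\<in>?I. (if p = (k, l) then U $$ p / 2 else 0) + (if p = (l, k) then U $$ p / 2 else 0))"
        by (simp only:)
      also have "\<dots> = U $$ (k, l) / 2 + U $$ (l, k) / 2"
        unfolding sum.distrib using k l by (simp only: sum.delta finite_cartesian_product
            finite_atLeastLessThan mem_Sigma_iff atLeastLessThan_iff if_True simp_thms le0)
      also have "\<dots> = U $$ (k, l)" using sym_mats_index_commute[OF U k l] by simp
      finally show ?case using k l by simp
    qed (use c in auto)
    then have "\<xi> U = (\<Sum>p\<in>?I. U $$ p / 2 * \<xi> (S p))"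
      using dual_space_sum[OF \<xi>, of ?I S "\<lambda>p. U $$ p / 2"] S by simp
    also have "\<dots> = (\<Sum>p\<in>?I. A $$ p * U $$ p)"
      by (rule sum.cong) (auto simp: A_def)
    finally show ?thesis by (simp add: sum.cartesian_product)
  qed
  with A that show ?thesis by blast
qed

lemma dual_space_sym_mats_diagonal_form:
  assumes \<xi>: "\<xi> \<in> dual_space (sym_mats n)"
  obtains Q \<alpha> where "Q \<in> carrier_mat n n" "transpose_mat Q * Q = 1\<^sub>m n"
    "\<And>U. U \<in> sym_mats n \<Longrightarrow> \<xi> U = (\<Sum>k\<in>{0..<n}. \<alpha> k * (transpose_mat Q * U * Q) $$ (k, k))"
proof -
  let ?S = "{0..<n}"
  obtain A where A: "A \<in> sym_mats n"
    and \<xi>A: "\<And>U. U \<in> sym_mats n \<Longrightarrow> \<xi> U = (\<Sum>i\<in>?S. \<Sum>j\<in>?S. A $$ (i, j) * U $$ (i, j))"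
    using dual_space_sym_mats_trace_form[OF \<xi>] by blast
  obtain Q \<alpha> where Q: "Q \<in> carrier_mat n n" "transpose_mat Q * Q = 1\<^sub>m n"
    and AQ: "A = Q * mat_diag n \<alpha> * transpose_mat Q"
    by (rule spectral_theorem_sym_mats[OF A])
  have "\<xi> U = (\<Sum>k\<in>?S. \<alpha> k * (transpose_mat Q * U * Q) $$ (k, k))" if U: "U \<in> sym_mats n" for U
  proof -
    have c: "U \<in> carrier_mat n n" using U by (simp add: sym_mats_def)
    let ?g = "\<lambda>i j k. \<alpha> k * (Q $$ (i, k) * U $$ (i, j) * Q $$ (j, k))"
    have "\<xi> U = (\<Sum>i\<in>?S. \<Sum>j\<in>?S. \<Sum>k\<in>?S. ?g i j k)"
      unfolding \<xi>A[OF U] AQ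
      by (intro sum.cong refl, subst index_mat_diag_conjugate[OF Q(1)])
        (auto simp: sum_distrib_left sum_distrib_right mult_ac)
    also have "\<dots> = (\<Sum>i\<in>?S. \<Sum>k\<in>?S. \<Sum>j\<in>?S. ?g i j k)"
      by (rule sum.cong[OF refl], rule sum.swap)
    also have "\<dots> = (\<Sum>k\<in>?S. \<Sum>i\<in>?S. \<Sum>j\<in>?S. ?g i j k)"
      by (rule sum.swap)
    also have "\<dots> = (\<Sum>k\<in>?S. \<alpha> k * (transpose_mat Q * U * Q) $$ (k, k))"
      by (intro sum.cong refl, subst index_mult_mat_transpose[OF Q(1) c])
        (auto simp: sum_distrib_left)
    finally show ?thesis .
  qed
  with Q that show ?thesis by blast
qed

section \<open>The image of the Hermite map\<close>

lemma hermite_map_in_dual_cone: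
  assumes X: "X \<in> sym_mats n" and y: "y \<in> carrier_vec n"
  shows "hermite_map n det (1\<^sub>m n) (X, y) \<in>
    dual_cone (sym_mats n) (hyperbolicity_cone (sym_mats n) det (1\<^sub>m n))"
proof -
  obtain Q l where Q: "Q \<in> carrier_mat n n" "transpose_mat Q * Q = 1\<^sub>m n"
    and XQ: "X = Q * mat_diag n l * transpose_mat Q"
    by (rule spectral_theorem_sym_mats[OF X])
  define d where "d U i = (transpose_mat Q * U * Q) $$ (i, i)" for U i
  define q where "q i = (\<Sum>k\<in>{0..<n}. y $ k * (- l i) ^ k)\<^sup>2" for i
  have map: "hermite_map n det (1\<^sub>m n) (X, y) U = (\<Sum>i\<in>{0..<n}. d U i * q i)" if "U \<in> sym_mats n" for U
    using hermite_mat_quadratic_form[OF Q _ XQ y, of U] that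
    by (simp add: hermite_map_def d_def q_def sym_mats_def)
  have entry: "d U i = (\<Sum>k\<in>{0..<n}. \<Sum>l\<in>{0..<n}. Q $$ (k, i) * U $$ (k, l) * Q $$ (l, i))"
    if "U \<in> carrier_mat n n" "i < n" for U i
    unfolding d_def by (rule index_mult_mat_transpose[OF Q(1) that(1,2,2)])
  have add: "d (U + V) i = d U i + d V i" if "U \<in> carrier_mat n n" "V \<in> carrier_mat n n" "i < n" for U V i
    using that by (simp add: entry sum.distrib algebra_simps)
  have smult: "d (c \<cdot>\<^sub>m U) i = c * d U i" if "U \<in> carrier_mat n n" "i < n" for c U i
    using that by (simp add: entry sum_distrib_left mult_ac)
  have "hermite_map n det (1\<^sub>m n) (X, y) \<in> dual_space (sym_mats n)"
    unfolding dual_space_def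
  proof (intro CollectI conjI ballI allI)
    show "hermite_map n det (1\<^sub>m n) (X, y) \<in> extensional (sym_mats n)"
      by (simp add: hermite_map_def)
  next
    fix U V assume "U \<in> sym_mats n" "V \<in> sym_mats n"
    then show "hermite_map n det (1\<^sub>m n) (X, y) (U + V) =
        hermite_map n det (1\<^sub>m n) (X, y) U + hermite_map n det (1\<^sub>m n) (X, y) V"
      by (simp add: map sym_mats_add add[OF sym_mats_carrier sym_mats_carrier] sum.distrib[symmetric] distrib_right)
  next
    fix c U assume "U \<in> sym_mats n"
    then show "hermite_map n det (1\<^sub>m n) (X, y) (c \<cdot>\<^sub>m U) = c * hermite_map n det (1\<^sub>m n) (X, y) U"
      by (simp add: map sym_mats_smult smult[OF sym_mats_carrier] sum_distrib_left mult.assoc)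
  qed
  moreover have "0 \<le> hermite_map n det (1\<^sub>m n) (X, y) U"
    if U: "U \<in> hyperbolicity_cone (sym_mats n) det (1\<^sub>m n)" for U
  proof -
    have "U \<in> sym_mats n" using U by (simp add: hyperbolicity_cone_def)
    then show ?thesis
      using hyperbolicity_cone_diagonal_nonneg[OF U Q(1)]
      by (auto simp: map d_def q_def intro!: sum_nonneg mult_nonneg_nonneg)
  qed
  ultimately show ?thesis by (simp add: dual_cone_def)
qed

text \<open>
  In dimension at least two the polynomial \<open>t\<close> is available, and \<open>- l i\<close> can be taken to be a
  square root of \<open>\<alpha> i\<close>. In dimension one only constants are available, but there is also
  only one value to attain.
\<close>

lemma prescribed_squares_by_polynomial:
  fixes \<alpha> :: "nat \<Rightarrow> real"
  assumes \<alpha>: "\<And>i. i < n \<Longrightarrow> 0 \<le> \<alpha> i"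
  obtains l y where "y \<in> carrier_vec n"
    "\<And>i. i < n \<Longrightarrow> (\<Sum>k\<in>{0..<n}. y $ k * (- l i) ^ k)\<^sup>2 = \<alpha> i"
proof (cases "2 \<le> n")
  case True
  have "(\<Sum>k\<in>{0..<n}. unit_vec n 1 $ k * (- (- sqrt (\<alpha> i))) ^ k) = sqrt (\<alpha> i)" for i
  proof -
    have "(\<Sum>k\<in>{0..<n}. unit_vec n 1 $ k * (- (- sqrt (\<alpha> i))) ^ k) =
        (\<Sum>k\<in>{0..<n}. if k = 1 then sqrt (\<alpha> i) else 0)"
      by (rule sum.cong) (use True in auto)
    then show ?thesis using True by simp
  qed
  then show ?thesis
    using that[of "unit_vec n 1" "\<lambda>i. - sqrt (\<alpha> i)"] \<alpha> by simp
next
  case False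
  then have "n = 0 \<or> n = 1" by auto
  then show ?thesis
    using that[of "vec n (\<lambda>_. sqrt (\<alpha> 0))" "\<lambda>_. 0"] \<alpha> by auto
qed

lemma dual_cone_in_hermite_map_image:
  assumes \<xi>: "\<xi> \<in> dual_cone (sym_mats n) (hyperbolicity_cone (sym_mats n) det (1\<^sub>m n))"
  shows "\<xi> \<in> hermite_map n det (1\<^sub>m n) ` (sym_mats n \<times> carrier_vec n)"
proof -
  have \<xi>V: "\<xi> \<in> dual_space (sym_mats n)" using \<xi> by (simp add: dual_cone_def)
  obtain Q \<alpha> where Q: "Q \<in> carrier_mat n n" "transpose_mat Q * Q = 1\<^sub>m n"
    and \<xi>Q: "\<And>U. U \<in> sym_mats n \<Longrightarrow> \<xi> U = (\<Sum>k\<in>{0..<n}. \<alpha> k * (transpose_mat Q * U * Q) $$ (k, k))"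
    using dual_space_sym_mats_diagonal_form[OF \<xi>V] by blast
  have \<alpha>: "0 \<le> \<alpha> i" if i: "i < n" for i
  proof -
    \<comment> \<open>\<open>?E\<close> below is the orthogonal projection onto the line spanned by column \<open>i\<close> of \<open>Q\<close>.\<close>
    let ?\<delta> = "\<lambda>k. if k = i then 1 else 0 :: real"
    let ?E = "Q * mat_diag n ?\<delta> * transpose_mat Q"
    have E: "?E \<in> hyperbolicity_cone (sym_mats n) det (1\<^sub>m n)"
      using mat_diag_conjugate_in_cone_iff[OF Q] by simp
    have "\<xi> ?E = (\<Sum>k\<in>{0..<n}. \<alpha> k * (transpose_mat Q * ?E * Q) $$ (k, k))"
      by (rule \<xi>Q[OF mat_diag_conjugate_sym_mats[OF Q(1)]])
    also have "transpose_mat Q * ?E * Q = mat_diag n ?\<delta>"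
      by (rule orthogonal_conjugate_cancel(2)[OF Q mat_diag_dim])
    also have "(\<Sum>k\<in>{0..<n}. \<alpha> k * mat_diag n ?\<delta> $$ (k, k)) = (\<Sum>k\<in>{0..<n}. if k = i then \<alpha> k else 0)"
      by (rule sum.cong) (auto simp: mat_diag_def)
    also have "\<dots> = \<alpha> i" using i by simp
    finally have "\<xi> ?E = \<alpha> i" .
    moreover have "0 \<le> \<xi> ?E" using E \<xi> unfolding dual_cone_def by blast
    ultimately show ?thesis by simp
  qed
  then obtain l y where y: "y \<in> carrier_vec n"
    and ly: "\<And>i. i < n \<Longrightarrow> (\<Sum>k\<in>{0..<n}. y $ k * (- l i) ^ k)\<^sup>2 = \<alpha> i"
    using prescribed_squares_by_polynomial[of n \<alpha>] by blast
  define X where "X = Q * mat_diag n l * transpose_mat Q"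
  have X: "X \<in> sym_mats n" unfolding X_def by (rule mat_diag_conjugate_sym_mats[OF Q(1)])
  have "\<xi> = hermite_map n det (1\<^sub>m n) (X, y)"
  proof (rule extensionalityI[of _ "sym_mats n"])
    show "\<xi> \<in> extensional (sym_mats n)" using \<xi>V by (simp add: dual_space_def)
    show "hermite_map n det (1\<^sub>m n) (X, y) \<in> extensional (sym_mats n)" by (simp add: hermite_map_def)
  next
    fix U assume U: "U \<in> sym_mats n"
    then have c: "U \<in> carrier_mat n n" by (simp add: sym_mats_def)
    show "\<xi> U = hermite_map n det (1\<^sub>m n) (X, y) U"
      using U ly hermite_mat_quadratic_form[OF Q c X_def y]
      by (simp add: hermite_map_def \<xi>Q mult.commute)
  qed
  with X y show ?thesis by blast
qed

theorem proposition7p7: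
  fixes d :: nat
  shows "hermite_map d det (1\<^sub>m d) ` (sym_mats d \<times> carrier_vec d) =
    dual_cone (sym_mats d) (hyperbolicity_cone (sym_mats d) det (1\<^sub>m d))"
  using hermite_map_in_dual_cone dual_cone_in_hermite_map_image by fast

end
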